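(* Let $n\ge1$ and let $\mathcal A\subset\operatorname{End}(\mathbb C^n)$ be an irreducible commutative totally symmetric set of cardinality $k$. Then there is a weight $\vec\lambda:[k]\to\mathbb C$ such that $\mathcal A\cong\mathcal A(\vec\lambda)$. If the level sets of $\vec\lambda$ have sizes $k_1,\dots,k_m$, the dimension of the space $V_{\vec\lambda}\cong\mathbb C^n$ on which $\mathcal A(\vec\lambda)$ acts is the multinomial coefficient $\binom{k}{k_1,\dots,k_m}=\frac{k!}{k_1!\cdots k_m!}$.
   Context: $[k]=\{1,\dots,k\}$, $\Sigma_k$ is its symmetric group. A totally symmetric set $\mathcal A=\{A_1,\dots,A_k\}\subset\operatorname{End}(V)$ ($V$ a finite-dimensional complex vector space) is an indexed collection for which there is a set map (not necessarily a homomorphism) $\rho:\Sigma_k\to\mathrm{GL}(V)$, called a realization map, with $\rho(\sigma)A_i\rho(\sigma)^{-1}=A_{\sigma(i)}$ for all $\sigma\in\Sigma_k$, $i\in[k]$. Either the $A_i$ are pairwise distinct, or they are all equal (the degenerate case, which is allowed here, with $k$ counting indices). $\mathcal A$ is commutative if the $A_i$ pairwise commute. $\mathcal A$ is reducible if there exist a realization map $\rho$ for $\mathcal A$ and a subspace $W\le V$ of positive dimension and positive codimension which is invariant under all $A_i$ and under all $\rho(\sigma)$, $\sigma\in\Sigma_k$. Otherwise $\mathcal A$ is irreducible. $\mathcal A=\{A_i\}_{i\in[k]}\subset\operatorname{End}(V)$ and $\mathcal B=\{B_i\}_{i\in[k]}\subset\operatorname{End}(W)$ are isomorphic ($\mathcal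 A\cong\mathcal B$) if there is a linear isomorphism $T:V\to W$ with $B_i=TA_iT^{-1}$ for all $i$. A weight is a function $\vec\lambda:[k]\to\mathbb C$. $V_{\vec\lambda}$ is the vector space with basis the set of distinct functions of the form $\vec\lambda\circ\sigma:[k]\to\mathbb C$, $\sigma\in\Sigma_k$ (two such functions are identified when they agree everywhere). $\mathcal A(\vec\lambda)=\{A_1,\dots,A_k\}\subset\operatorname{End}(V_{\vec\lambda})$ is given by $A_i(\vec\lambda\circ\sigma)=\vec\lambda(\sigma(i))\,(\vec\lambda\circ\sigma)$ on basis elements; it is totally symmetric. *)

theory Defs
  imports "HOL-Analysis.Analysis" "HOL-Combinatorics.Permutations" "HOL-Library.Poly_Mapping"
begin

text \<open>
  A complex vector space is given by a scalar multiplication \<open>s\<close> on an ambient type and a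
  subspace \<open>V\<close> of it; \<open>V = UNIV\<close> is allowed. Maps on \<open>V\<close> are functions on the ambient type
  whose values outside \<open>V\<close> are irrelevant. A collection indexed by \<open>{1..k}\<close> is a function
  on \<open>nat\<close> whose values outside \<open>{1..k}\<close> are irrelevant.
\<close>

definition linear_between ::
  "(complex \<Rightarrow> 'v::ab_group_add \<Rightarrow> 'v) \<Rightarrow> 'v set \<Rightarrow> (complex \<Rightarrow> 'w::ab_group_add \<Rightarrow> 'w) \<Rightarrow> 'w set \<Rightarrow> ('v \<Rightarrow> 'w) set"
  where "linear_between s V t W =
    {T. (\<forall>x\<in>V. T x \<in> W) \<and> (\<forall>x\<in>V. \<forall>y\<in>V. T (x + y) = T x + T y) \<and>
        (\<forall>c. \<forall>x\<in>V. T (s c x) = t c (T x))}"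

definition End_on :: "(complex \<Rightarrow> 'v::ab_group_add \<Rightarrow> 'v) \<Rightarrow> 'v set \<Rightarrow> ('v \<Rightarrow> 'v) set"
  where "End_on s V = linear_between s V s V"

definition GL_on :: "(complex \<Rightarrow> 'v::ab_group_add \<Rightarrow> 'v) \<Rightarrow> 'v set \<Rightarrow> ('v \<Rightarrow> 'v) set"
  where "GL_on s V = {T \<in> End_on s V. bij_betw T V V}"

definition realization_map ::
  "(complex \<Rightarrow> 'v::ab_group_add \<Rightarrow> 'v) \<Rightarrow> 'v set \<Rightarrow> nat \<Rightarrow> (nat \<Rightarrow> 'v \<Rightarrow> 'v) \<Rightarrow> ((nat \<Rightarrow> nat) \<Rightarrow> 'v \<Rightarrow> 'v) \<Rightarrow> bool"
  where "realization_map s V k A \<rho> \<longleftrightarrow>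
    (\<forall>\<sigma>. \<sigma> permutes {1..k} \<longrightarrow> \<rho> \<sigma> \<in> GL_on s V \<and>
      (\<forall>i\<in>{1..k}. \<forall>x\<in>V. \<rho> \<sigma> (A i (inv_into V (\<rho> \<sigma>) x)) = A (\<sigma> i) x))"

definition totally_symmetric ::
  "(complex \<Rightarrow> 'v::ab_group_add \<Rightarrow> 'v) \<Rightarrow> 'v set \<Rightarrow> nat \<Rightarrow> (nat \<Rightarrow> 'v \<Rightarrow> 'v) \<Rightarrow> bool"
  where "totally_symmetric s V k A \<longleftrightarrow>
    (\<forall>i\<in>{1..k}. A i \<in> End_on s V) \<and> (\<exists>\<rho>. realization_map s V k A \<rho>)"

text \<open>The members are automatically either pairwise distinct or all equal:\<close>

lemma totally_symmetric_distinct_or_equal: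
  assumes "totally_symmetric s V k A"
  shows "(\<forall>i\<in>{1..k}. \<forall>j\<in>{1..k}. i \<noteq> j \<longrightarrow> (\<exists>x\<in>V. A i x \<noteq> A j x)) \<or>
         (\<forall>i\<in>{1..k}. \<forall>j\<in>{1..k}. \<forall>x\<in>V. A i x = A j x)"
proof (rule disjCI)
  assume "\<not> (\<forall>i\<in>{1..k}. \<forall>j\<in>{1..k}. \<forall>x\<in>V. A i x = A j x)"
  then obtain a b x where ab: "a \<in> {1..k}" "b \<in> {1..k}" "x \<in> V" "A a x \<noteq> A b x"
    by blast
  obtain \<rho> where \<rho>: "realization_map s V k A \<rho>"
    using assms by (auto simp: totally_symmetric_def)
  show "\<forall>i\<in>{1..k}. \<forall>j\<in>{1..k}. i \<noteq> j \<longrightarrow> (\<exists>x\<in>V. A i x \<noteq> A j x)"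
  proof (intro ballI impI)
    fix i j assume ij: "i \<in> {1..k}" "j \<in> {1..k}" "i \<noteq> j"
    define \<tau> where "\<tau> = Transposition.transpose i a"
    define \<sigma> where "\<sigma> = Transposition.transpose (\<tau> j) b \<circ> \<tau>"
    have \<tau>: "\<tau> permutes {1..k}"
      unfolding \<tau>_def using ij ab by (intro permutes_swap_id)
    have \<tau>j: "\<tau> j \<in> {1..k}" "\<tau> j \<noteq> a" "\<tau> i = a"
      using ij permutes_in_image[OF \<tau>] by (auto simp: \<tau>_def Transposition.transpose_def)
    have \<sigma>: "\<sigma> permutes {1..k}"
      unfolding \<sigma>_def using \<tau> \<tau>j ab by (intro permutes_compose permutes_swap_id)
    have "a \<noteq> b" using ab by auto
    then have \<sigma>ij: "\<sigma> i = a" "\<sigma> j = b"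
      using \<tau>j by (auto simp: \<sigma>_def Transposition.transpose_def)
    have eq: "\<rho> \<sigma> (A l (inv_into V (\<rho> \<sigma>) x)) = A (\<sigma> l) x" if "l \<in> {1..k}" for l
      using \<rho> \<sigma> that ab(3) unfolding realization_map_def by blast
    have "bij_betw (\<rho> \<sigma>) V V"
      using \<rho> \<sigma> unfolding realization_map_def GL_on_def by blast
    then have "inv_into V (\<rho> \<sigma>) x \<in> V"
      using ab(3) by (auto simp: bij_betw_def intro: inv_into_into)
    moreover have "A i (inv_into V (\<rho> \<sigma>) x) \<noteq> A j (inv_into V (\<rho> \<sigma>) x)"
      using eq[OF ij(1)] eq[OF ij(2)] \<sigma>ij ab(4) by auto
    ultimately show "\<exists>x\<in>V. A i x \<noteq> A j x" by blast
  qed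
qed

definition commutative_on :: "'v set \<Rightarrow> nat \<Rightarrow> (nat \<Rightarrow> 'v \<Rightarrow> 'v) \<Rightarrow> bool"
  where "commutative_on V k A \<longleftrightarrow>
    (\<forall>i\<in>{1..k}. \<forall>j\<in>{1..k}. \<forall>x\<in>V. A i (A j x) = A j (A i x))"

definition reducible ::
  "(complex \<Rightarrow> 'v::ab_group_add \<Rightarrow> 'v) \<Rightarrow> 'v set \<Rightarrow> nat \<Rightarrow> (nat \<Rightarrow> 'v \<Rightarrow> 'v) \<Rightarrow> bool"
  where "reducible s V k A \<longleftrightarrow>
    (\<exists>\<rho> W. realization_map s V k A \<rho> \<and> module.subspace s W \<and> W \<subseteq> V \<and>
      0 < vector_space.dim s W \<and> vector_space.dim s W < vector_space.dim s V \<and>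
      (\<forall>i\<in>{1..k}. A i ` W \<subseteq> W) \<and> (\<forall>\<sigma>. \<sigma> permutes {1..k} \<longrightarrow> \<rho> \<sigma> ` W \<subseteq> W))"

definition isomorphic_on ::
  "(complex \<Rightarrow> 'v::ab_group_add \<Rightarrow> 'v) \<Rightarrow> 'v set \<Rightarrow> (complex \<Rightarrow> 'w::ab_group_add \<Rightarrow> 'w) \<Rightarrow> 'w set \<Rightarrow> nat \<Rightarrow>
   (nat \<Rightarrow> 'v \<Rightarrow> 'v) \<Rightarrow> (nat \<Rightarrow> 'w \<Rightarrow> 'w) \<Rightarrow> bool"
  where "isomorphic_on s V t W k A B \<longleftrightarrow>
    (\<exists>T \<in> linear_between s V t W. bij_betw T V W \<and>
      (\<forall>i\<in>{1..k}. \<forall>y\<in>W. B i y = T (A i (inv_into V T y))))"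


text \<open>
  \<open>'b \<Rightarrow>\<^sub>0 complex\<close> is the free complex vector space on \<open>'b\<close>, the basis vector of \<open>w\<close>
  being \<open>Poly_Mapping.single w 1\<close>.
\<close>

definition free_scale :: "complex \<Rightarrow> ('b \<Rightarrow>\<^sub>0 complex) \<Rightarrow> ('b \<Rightarrow>\<^sub>0 complex)"
  where "free_scale c = Poly_Mapping.map ((*) c)"

lemma lookup_free_scale [simp]:
  "Poly_Mapping.lookup (free_scale c v) w = c * Poly_Mapping.lookup v w"
  by (simp add: free_scale_def map.rep_eq when_def)

interpretation free: vector_space free_scale
  by unfold_locales (auto intro!: poly_mapping_eqI simp: lookup_add algebra_simps)

text \<open>
  Weights are functions on \<open>{1..k}\<close>, made total by the default value \<open>undefined\<close> outside.
  A permutation of \<open>{1..k}\<close> is the identity outside, so composing with it gives a weight again.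
\<close>

definition weights :: "nat \<Rightarrow> (nat \<Rightarrow> complex) set"
  where "weights k = {1..k} \<rightarrow>\<^sub>E UNIV"

definition weight_orbit :: "nat \<Rightarrow> (nat \<Rightarrow> complex) \<Rightarrow> (nat \<Rightarrow> complex) set"
  where "weight_orbit k lam = {lam \<circ> \<sigma> |\<sigma>. \<sigma> permutes {1..k}}"

definition weight_space :: "nat \<Rightarrow> (nat \<Rightarrow> complex) \<Rightarrow> ((nat \<Rightarrow> complex) \<Rightarrow>\<^sub>0 complex) set"
  where "weight_space k lam = free.span ((\<lambda>w. Poly_Mapping.single w 1) ` weight_orbit k lam)"

text \<open>
  The basis vector of \<open>w = lam \<circ> \<sigma>\<close> has eigenvalue \<open>lam (\<sigma> i) = w i\<close>, so the \<open>i\<close>-th operator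
  multiplies the coefficient at \<open>w\<close> by \<open>w i\<close>. This formula does not mention \<open>lam\<close>, which
  enters only through the space acted on.
\<close>

definition weight_op :: "nat \<Rightarrow> ((nat \<Rightarrow> complex) \<Rightarrow>\<^sub>0 complex) \<Rightarrow> ((nat \<Rightarrow> complex) \<Rightarrow>\<^sub>0 complex)"
  where "weight_op i = Poly_Mapping.mapp (\<lambda>w c. w i * c)"

lemma lookup_weight_op:
  "Poly_Mapping.lookup (weight_op i v) w = w i * Poly_Mapping.lookup v w"
  by (simp add: weight_op_def lookup_mapp when_def in_keys_iff)

lemma weight_op_basis:
  "weight_op i (Poly_Mapping.single (lam \<circ> \<sigma>) 1) =
     free_scale (lam (\<sigma> i)) (Poly_Mapping.single (lam \<circ> \<sigma>) 1)"
  by (intro poly_mapping_eqI) (auto simp: lookup_weight_op lookup_single when_def)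

lemma free_independent_basis:
  fixes S :: "'b set"
  shows "free.independent ((\<lambda>w. Poly_Mapping.single w 1) ` S)"
  unfolding free.independent_explicit_module
proof (intro allI impI)
  fix t and u :: "('b \<Rightarrow>\<^sub>0 complex) \<Rightarrow> complex" and v
  assume t: "finite t" "t \<subseteq> (\<lambda>w. Poly_Mapping.single w 1) ` S"
    and sum: "(\<Sum>v\<in>t. free_scale (u v) v) = 0" and v: "v \<in> t"
  from t v obtain w where w: "v = Poly_Mapping.single w 1" by auto
  have other: "Poly_Mapping.lookup x w = 0" if "x \<in> t - {v}" for x
    using that t w by (auto simp: lookup_single when_def)
  have "0 = (\<Sum>x\<in>t. u x * Poly_Mapping.lookup x w)"
    using arg_cong[OF sum, of "\<lambda>x. Poly_Mapping.lookup x w"] by (simp add: lookup_sum)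
  also have "\<dots> = u v * Poly_Mapping.lookup v w"
    using t v other by (subst sum.remove[of t v]) auto
  finally show "u v = 0" by (simp add: w)
qed

lemma weight_space_eq:
  "weight_space k lam = {v. Poly_Mapping.keys v \<subseteq> weight_orbit k lam}"
proof (intro equalityI subsetI)
  fix v assume "v \<in> weight_space k lam"
  then have "v \<in> free.span ((\<lambda>w. Poly_Mapping.single w 1) ` weight_orbit k lam)"
    by (simp add: weight_space_def)
  then have "Poly_Mapping.keys v \<subseteq> weight_orbit k lam"
  proof (induction rule: free.span_induct)
    case base
    show ?case
    proof (rule free.subspaceI)
      show "x + y \<in> {x. Poly_Mapping.keys x \<subseteq> weight_orbit k lam}"
        if "x \<in> {x. Poly_Mapping.keys x \<subseteq> weight_orbit k lam}"
          "y \<in> {x. Poly_Mapping.keys x \<subseteq> weight_orbit k lam}" for x y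
        using that keys_add[of x y] by auto
    qed (auto simp: in_keys_iff subset_iff)
  next
    case (step x)
    then show ?case by auto
  qed
  then show "v \<in> {v. Poly_Mapping.keys v \<subseteq> weight_orbit k lam}" by simp
next
  fix v :: "(nat \<Rightarrow> complex) \<Rightarrow>\<^sub>0 complex"
  assume v: "v \<in> {v. Poly_Mapping.keys v \<subseteq> weight_orbit k lam}"
  have "v = (\<Sum>w\<in>Poly_Mapping.keys v. free_scale (Poly_Mapping.lookup v w) (Poly_Mapping.single w 1))"
    by (intro poly_mapping_eqI)
      (simp add: lookup_sum lookup_single when_def in_keys_iff if_distrib[of "(*) _"] cong: if_cong)
  also have "\<dots> \<in> weight_space k lam"
    unfolding weight_space_def using v
    by (intro free.span_sum free.span_scale free.span_base) auto
  finally show "v \<in> weight_space k lam" .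
qed

lemma totally_symmetric_weight_op:
  "totally_symmetric free_scale (weight_space k lam) k weight_op"
  unfolding totally_symmetric_def
proof (intro conjI ballI exI)
  fix i
  show "weight_op i \<in> End_on free_scale (weight_space k lam)"
    by (auto simp: End_on_def linear_between_def weight_space_eq lookup_weight_op lookup_add
          in_keys_iff subset_iff algebra_simps intro!: poly_mapping_eqI)
next
  define P :: "(nat \<Rightarrow> nat) \<Rightarrow> ((nat \<Rightarrow> complex) \<Rightarrow>\<^sub>0 complex) \<Rightarrow> ((nat \<Rightarrow> complex) \<Rightarrow>\<^sub>0 complex)"
    where "P \<sigma> = Poly_Mapping.map_key (\<lambda>w. w \<circ> \<sigma>)" for \<sigma>
  have lookup_P: "Poly_Mapping.lookup (P \<sigma> v) w = Poly_Mapping.lookup v (w \<circ> \<sigma>)"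
    if "\<sigma> permutes {1..k}" for \<sigma> and v :: "(nat \<Rightarrow> complex) \<Rightarrow>\<^sub>0 complex" and w
  proof -
    have "inj (\<lambda>w :: nat \<Rightarrow> complex. w \<circ> \<sigma>)"
      using permutes_surj[OF that] by (intro injI) (metis fun.map_comp surj_fun_eq)
    then show ?thesis by (simp add: P_def map_key.rep_eq)
  qed
  have orbit: "w \<circ> \<sigma> \<in> weight_orbit k lam" if "w \<in> weight_orbit k lam" "\<sigma> permutes {1..k}" for w \<sigma>
    using that by (auto simp: weight_orbit_def comp_assoc intro: permutes_compose)
  have orbit': "w \<in> weight_orbit k lam" if "w \<circ> \<sigma> \<in> weight_orbit k lam" "\<sigma> permutes {1..k}" for w \<sigma>
    using orbit[OF that(1) permutes_inv[OF that(2)]] permutes_inv_o(1)[OF that(2)]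
    by (simp add: comp_assoc)
  have PV: "P \<sigma> v \<in> weight_space k lam"
    if "\<sigma> permutes {1..k}" "v \<in> weight_space k lam" for \<sigma> v
    using that orbit'[OF _ that(1)] by (auto simp: weight_space_eq in_keys_iff lookup_P subset_iff)
  have inv1: "P \<sigma> (P (inv \<sigma>) v) = v" "P (inv \<sigma>) (P \<sigma> v) = v" if "\<sigma> permutes {1..k}" for \<sigma> v
    using that permutes_inv[OF that] permutes_inv_o[OF that]
    by (auto intro!: poly_mapping_eqI simp: lookup_P comp_assoc)
  have bij: "bij_betw (P \<sigma>) (weight_space k lam) (weight_space k lam)" if "\<sigma> permutes {1..k}" for \<sigma>
    using that PV inv1 permutes_inv[OF that] by (intro bij_betwI[where g = "P (inv \<sigma>)"]) auto
  show "realization_map free_scale (weight_space k lam) k weight_op P"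
    unfolding realization_map_def
  proof (intro allI impI conjI ballI)
    fix \<sigma> assume \<sigma>: "\<sigma> permutes {1..k}"
    show "P \<sigma> \<in> GL_on free_scale (weight_space k lam)"
      using bij[OF \<sigma>] PV[OF \<sigma>]
      by (auto simp: GL_on_def End_on_def linear_between_def lookup_P[OF \<sigma>] lookup_add
          intro!: poly_mapping_eqI)
    fix i x assume x: "x \<in> weight_space k lam"
    have "inv_into (weight_space k lam) (P \<sigma>) x = P (inv \<sigma>) x"
      using bij[OF \<sigma>] PV[OF permutes_inv[OF \<sigma>] x] inv1[OF \<sigma>]
      by (intro inv_into_f_eq) (auto simp: bij_betw_def)
    then show "P \<sigma> (weight_op i (inv_into (weight_space k lam) (P \<sigma>) x)) = weight_op (\<sigma> i) x"
      using permutes_inv_o[OF \<sigma>]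
      by (auto intro!: poly_mapping_eqI
          simp: lookup_P[OF \<sigma>] lookup_P[OF permutes_inv[OF \<sigma>]] lookup_weight_op comp_assoc)
  qed
qed

definition level_sets :: "nat \<Rightarrow> (nat \<Rightarrow> complex) \<Rightarrow> nat set set"
  where "level_sets k lam = (\<lambda>c. {i \<in> {1..k}. lam i = c}) ` lam ` {1..k}"

end

theory Submission
  imports Defs "HOL-Computational_Algebra.Fundamental_Theorem_Algebra"
    "HOL-Combinatorics.Multiset_Permutations"
begin

text \<open>
  Commuting operators on \<open>\<complex>\<^sup>n\<close> have a common eigenvector \<open>e\<close>; let \<open>lam\<close> list its eigenvalues, and
  let \<open>V\<^sub>w\<close> be the joint eigenspace of a weight \<open>w\<close>. The relation
  \<open>\<rho>(\<sigma>) A\<^sub>i = A\<^bsub>\<sigma>(i)\<^esub> \<rho>(\<sigma>)\<close> makes \<open>\<rho>(\<sigma>)\<close> carry \<open>V\<^sub>w\<close> isomorphically onto the eigenspace of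
  \<open>w \<circ> \<sigma>\<inverse>\<close>, so the sum of the \<open>V\<^sub>w\<close> over the orbit of \<open>lam\<close> is invariant under everything, and
  irreducibility makes it the whole space (\<open>irreducible_sum_of_eigenspaces\<close>). Eigenspaces of
  distinct weights are independent, hence \<open>\<complex>\<^sup>n\<close> is the direct sum of the \<open>V\<^sub>w\<close>.

  The substance is that each \<open>V\<^sub>w\<close> is a line (\<open>irreducible_eigenbasis\<close>). Nothing forces the given
  realization map to preserve a choice of lines, because its values compose only up to operators
  commuting with all \<open>A\<^sub>i\<close>. But irreducibility speaks of every realization map, so a better one can
  be used. Choosing one isomorphism \<open>V\<^bsub>lam\<^esub> \<rightarrow> V\<^sub>w\<close> for each \<open>w\<close> in the orbit identifies \<open>\<complex>\<^sup>n\<close> with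
  the functions from the orbit to \<open>V\<^bsub>lam\<^esub>\<close>; permuting the arguments of these functions is a realization
  map \<open>\<rho>'\<close>, now even a homomorphism. The functions with values in the line spanned by \<open>e\<close> form a
  nonzero subspace invariant under \<open>\<rho>'\<close> and all \<open>A\<^sub>i\<close>, so they are everything.

  Thus there is a basis of eigenvectors indexed by the orbit, one for each weight, which is an
  isomorphism with the model on \<open>weight_space\<close>. The dimension is the size of the orbit: listing the
  values of a weight turns the orbit into the set of arrangements of the multiset of values
  of \<open>lam\<close>, which is counted by a multinomial coefficient.
\<close>

section \<open>Eigenvectors\<close>

text \<open>
  The vector \<open>p(f) x\<close>, in Horner form. The form without powers of \<open>f\<close> makes induction over the
  coefficients of \<open>p\<close> immediate.
\<close>

definition poly_act :: "(complex ^ 'n \<Rightarrow> complex ^ 'n) \<Rightarrow> complex poly \<Rightarrow> complex ^ 'n \<Rightarrow> complex ^ 'n"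
  where "poly_act f p x = fold_coeffs (\<lambda>a v. a *s x + f v) p 0"

context
  fixes f :: "complex ^ 'n \<Rightarrow> complex ^ 'n"
  assumes f: "Vector_Spaces.linear (*s) (*s) f"
begin

lemma poly_act_0 [simp]: "poly_act f 0 x = 0"
  by (simp add: poly_act_def)

lemma poly_act_pCons [simp]: "poly_act f (pCons a p) x = a *s x + f (poly_act f p x)"
  by (cases "a = 0 \<and> p = 0") (auto simp: poly_act_def vec.linear_0[OF f])

lemma poly_act_add: "poly_act f (p + q) x = poly_act f p x + poly_act f q x"
  by (induction p q rule: poly_induct2)
    (simp_all add: vec.linear_add[OF f] vec.scale_left_distrib)

lemma poly_act_smult: "poly_act f (smult c p) x = c *s poly_act f p x"
  by (induction p)
    (simp_all add: vec.linear_scale[OF f] vec.scale_right_distrib)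

lemma poly_act_sum: "poly_act f (\<Sum>i\<in>I. p i) x = (\<Sum>i\<in>I. poly_act f (p i) x)"
  by (induction I rule: infinite_finite_induct) (simp_all add: poly_act_add)

lemma poly_act_monom: "poly_act f (monom c i) x = c *s (f ^^ i) x"
  by (induction i) (simp_all add: monom_0 monom_Suc vec.linear_scale[OF f] vec.linear_0[OF f])

lemma poly_act_in_invariant_subspace:
  assumes "vec.subspace W" "f ` W \<subseteq> W" "x \<in> W"
  shows "poly_act f p x \<in> W"
  by (induction p) (use assms in \<open>auto intro!: vec.subspace_add vec.subspace_scale vec.subspace_0\<close>)

text \<open>
  The infinitely many iterates of \<open>f\<close> on \<open>x\<close> are linearly dependent in finite dimension. Two equal
  iterates must be treated apart, since a set of vectors does not see repetitions.
\<close>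

lemma exists_annihilating_poly:
  "\<exists>p. p \<noteq> 0 \<and> poly_act f p x = 0"
proof (cases "inj (\<lambda>i. (f ^^ i) x)")
  case False
  then obtain i j where ij: "i \<noteq> j" "(f ^^ i) x = (f ^^ j) x"
    by (auto simp: inj_def)
  have "coeff (monom 1 i + monom (- 1 :: complex) j) i \<noteq> 0"
    using ij by simp
  then have "monom 1 i + monom (- 1 :: complex) j \<noteq> 0"
    by (metis coeff_0)
  moreover have "poly_act f (monom 1 i + monom (- 1) j) x = 0"
    using ij by (simp add: poly_act_add poly_act_monom)
  ultimately show ?thesis by blast
next
  case True
  define g where "g i = (f ^^ i) x" for i :: nat
  have inj: "inj g" using True by (simp add: g_def[abs_def])
  have "infinite (range g)"
    using inj by (rule range_inj_infinite)
  then have "vec.dependent (range g)"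
    using vec.finiteI_independent by blast
  then obtain t u v where t: "finite t" "t \<subseteq> range g" "v \<in> t" "u v \<noteq> 0" "(\<Sum>v\<in>t. u v *s v) = 0"
    unfolding vec.dependent_explicit by blast
  define I where "I = g -` t"
  have I: "finite I" "g ` I = t"
    using t inj finite_vimageI by (auto simp: I_def image_vimage_eq)
  define p where "p = (\<Sum>i\<in>I. monom (u (g i)) i)"
  obtain j where j: "j \<in> I" "v = g j" using t(3) I by auto
  have "coeff p j = u v"
    using I j by (simp add: p_def coeff_sum)
  then have "p \<noteq> 0" using t(4) by auto
  have "poly_act f p x = (\<Sum>i\<in>I. u (g i) *s g i)"
    by (simp add: p_def poly_act_sum poly_act_monom g_def)
  also have "\<dots> = (\<Sum>v\<in>g ` I. u v *s v)"
    using inj by (subst sum.reindex) (auto simp: inj_def inj_on_def)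
  also have "\<dots> = 0" using I t by simp
  finally show ?thesis using \<open>p \<noteq> 0\<close> by blast
qed

text \<open>
  Take \<open>p\<close> of least degree among the nonzero polynomials with \<open>p(f) x = 0\<close>, and split off a root:
  \<open>p = (X - z) q\<close>. By minimality \<open>q(f) x \<noteq> 0\<close>, and \<open>f - z\<close> kills it. It lies in \<open>W\<close>, being a
  combination of iterates of \<open>f\<close> on \<open>x\<close>.
\<close>

lemma eigenvector_in_invariant_subspace:
  assumes W: "vec.subspace W" "f ` W \<subseteq> W" and x: "x \<in> W" "x \<noteq> 0"
  obtains z y where "y \<in> W" "y \<noteq> 0" "f y = z *s y"
proof -
  obtain p where p: "p \<noteq> 0" "poly_act f p x = 0"
    and least: "\<And>q. q \<noteq> 0 \<Longrightarrow> poly_act f q x = 0 \<Longrightarrow> degree p \<le> degree q"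
    using ex_has_least_nat[of "\<lambda>p. p \<noteq> 0 \<and> poly_act f p x = 0" _ degree]
      exists_annihilating_poly[of x] by blast
  have "\<exists>z. poly p z = 0"
  proof (rule fundamental_theorem_of_algebra_alt)
    show "\<not> (\<exists>a l. a \<noteq> 0 \<and> l = 0 \<and> p = pCons a l)"
      using p x by (auto simp: vec.linear_0[OF f])
  qed
  then obtain z q where q: "p = [:- z, 1:] * q"
    by (metis poly_eq_0_iff_dvd dvdE)
  have "q \<noteq> 0" using p q by auto
  then have "degree q < degree p"
    unfolding q by (subst degree_mult_eq) auto
  then have "poly_act f q x \<noteq> 0"
    using least[OF \<open>q \<noteq> 0\<close>] by auto
  moreover have "f (poly_act f q x) = z *s poly_act f q x"
    using p(2) poly_act_add[of "smult (- z) q" "pCons 0 q" x] unfolding q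
    by (simp add: poly_act_smult[of "- z"] del: smult_minus_left)
  ultimately show thesis
    using that poly_act_in_invariant_subspace[OF W x(1)] by blast
qed

end


section \<open>Joint eigenspaces\<close>

definition joint_eigenspace ::
  "nat \<Rightarrow> (nat \<Rightarrow> complex ^ 'n \<Rightarrow> complex ^ 'n) \<Rightarrow> (nat \<Rightarrow> complex) \<Rightarrow> (complex ^ 'n) set"
  where "joint_eigenspace k A w = {x. \<forall>i\<in>{1..k}. A i x = w i *s x}"

lemma End_on_UNIV_iff: "f \<in> End_on (*s) UNIV \<longleftrightarrow> Vector_Spaces.linear (*s) (*s) f"
  for f :: "complex ^ 'n \<Rightarrow> complex ^ 'n"
  unfolding End_on_def linear_between_def Vector_Spaces.linear_def module_hom_iff
  using vec.vector_space_axioms vec.module_axioms by auto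

lemma subspace_joint_eigenspace:
  assumes "\<And>i. i \<in> {1..k} \<Longrightarrow> Vector_Spaces.linear (*s) (*s) (A i)"
  shows "vec.subspace (joint_eigenspace k A w)"
  unfolding joint_eigenspace_def vec.subspace_def using assms
  by (auto simp: vec.linear_0 vec.linear_add vec.linear_scale vec.scale_right_distrib mult.commute)

text \<open>
  The joint eigenspace of the first \<open>k\<close> operators is invariant under the next one by
  commutativity, so that one has an eigenvector there.
\<close>

lemma common_eigenvector:
  fixes A :: "nat \<Rightarrow> complex ^ 'n \<Rightarrow> complex ^ 'n"
  assumes "\<And>i. i \<in> {1..k} \<Longrightarrow> Vector_Spaces.linear (*s) (*s) (A i)"
    and "commutative_on UNIV k A"
  shows "\<exists>w x. x \<noteq> 0 \<and> x \<in> joint_eigenspace k A w"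
  using assms
proof (induction k)
  case 0
  have "axis undefined 1 \<noteq> (0 :: complex ^ 'n)" by (simp add: axis_eq_0_iff)
  then show ?case by (auto simp: joint_eigenspace_def)
next
  case (Suc k)
  have lin: "Vector_Spaces.linear (*s) (*s) (A i)" if "i \<in> {1..k}" for i
    using Suc.prems(1) that by auto
  have lin': "Vector_Spaces.linear (*s) (*s) (A (Suc k))"
    using Suc.prems(1) by auto
  have "commutative_on UNIV k A"
    using Suc.prems(2) by (auto simp: commutative_on_def)
  then obtain w x where x: "x \<noteq> 0" "x \<in> joint_eigenspace k A w"
    using Suc.IH lin by blast
  have inv: "A (Suc k) ` joint_eigenspace k A w \<subseteq> joint_eigenspace k A w"
  proof clarify
    fix y assume y: "y \<in> joint_eigenspace k A w"
    have "A i (A (Suc k) y) = w i *s A (Suc k) y" if "i \<in> {1..k}" for i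
    proof -
      have "A i (A (Suc k) y) = A (Suc k) (A i y)"
        using Suc.prems(2) that unfolding commutative_on_def by auto
      also have "\<dots> = w i *s A (Suc k) y"
        using y that by (simp add: joint_eigenspace_def vec.linear_scale[OF lin'])
      finally show ?thesis .
    qed
    then show "A (Suc k) y \<in> joint_eigenspace k A w"
      by (simp add: joint_eigenspace_def)
  qed
  obtain z y where y: "y \<in> joint_eigenspace k A w" "y \<noteq> 0" "A (Suc k) y = z *s y"
    using eigenvector_in_invariant_subspace[OF lin' subspace_joint_eigenspace[OF lin] inv x(2,1)]
    by blast
  have "y \<in> joint_eigenspace (Suc k) A (w(Suc k := z))"
    using y by (auto simp: joint_eigenspace_def le_Suc_eq)
  then show ?case using y(2) by blast
qed

text \<open>
  Restricting to \<open>weights k\<close> ensures that distinct members of \<open>F\<close> differ at some \<open>i \<in> {1..k}\<close>, hence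
  that \<open>A i\<close> has different eigenvalues on their eigenspaces.
\<close>

lemma joint_eigenspaces_independent:
  assumes lin: "\<And>i. i \<in> {1..k} \<Longrightarrow> Vector_Spaces.linear (*s) (*s) (A i)"
    and "finite F" "F \<subseteq> weights k" "\<And>w. w \<in> F \<Longrightarrow> y w \<in> joint_eigenspace k A w"
    and "(\<Sum>w\<in>F. y w) = 0" "w \<in> F"
  shows "y w = 0"
  using assms(2-)
proof (induction F arbitrary: y w rule: finite_induct)
  case empty
  then show ?case by simp
next
  case (insert v F)
  have F: "y u = 0" if u: "u \<in> F" for u
  proof -
    have "u \<noteq> v" using u insert.hyps by auto
    moreover have "u \<in> {1..k} \<rightarrow>\<^sub>E UNIV" "v \<in> {1..k} \<rightarrow>\<^sub>E UNIV"
      using insert.prems(1) u by (auto simp: weights_def)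
    ultimately obtain i where i: "i \<in> {1..k}" "u i \<noteq> v i"
      using PiE_ext by blast
    note lin_i = lin[OF i(1)]
    \<comment> \<open>Applying \<open>A i - v i\<close> to the relation removes the \<open>v\<close>-term and keeps a nonzero multiple of \<open>y u\<close>.\<close>
    define y' where "y' w = (w i - v i) *s y w" for w
    have eig: "A i (y w) = w i *s y w" if "w \<in> insert v F" for w
      using insert.prems(2)[OF that] i by (simp add: joint_eigenspace_def)
    have "(\<Sum>w\<in>F. y' w) = (\<Sum>w\<in>insert v F. y' w)"
      using insert.hyps by (simp add: y'_def)
    also have "\<dots> = (\<Sum>w\<in>insert v F. A i (y w) - v i *s y w)"
      by (rule sum.cong) (simp_all add: eig y'_def vec.scale_left_diff_distrib)
    also have "\<dots> = A i (\<Sum>w\<in>insert v F. y w) - v i *s (\<Sum>w\<in>insert v F. y w)"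
      by (simp only: sum_subtractf vec.linear_sum[OF lin_i] vec.scale_sum_right)
    also have "\<dots> = 0"
      by (simp only: insert.prems(3)) (simp add: vec.linear_0[OF lin_i])
    finally have "(\<Sum>w\<in>F. y' w) = 0" .
    moreover have "y' w \<in> joint_eigenspace k A w" if "w \<in> F" for w
      unfolding y'_def using insert.prems(2)[of w] that
      by (intro vec.subspace_scale[OF subspace_joint_eigenspace[OF lin]]) auto
    ultimately have "y' u = 0"
      using insert.IH[of y' u] insert.prems(1) u by auto
    then show ?thesis using i by (simp add: y'_def)
  qed
  then have "y v = 0" using insert.prems(3) insert.hyps by simp
  then show ?case using F insert.prems(4) by auto
qed


section \<open>Realization maps\<close>

text \<open>
  Conjugation by \<open>\<rho> \<sigma>\<close> rewritten as an intertwining relation, so that inverses disappear.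
\<close>

lemma realization_map_UNIV_iff:
  fixes A :: "nat \<Rightarrow> complex ^ 'n \<Rightarrow> complex ^ 'n"
  shows "realization_map (*s) UNIV k A \<rho> \<longleftrightarrow>
    (\<forall>\<sigma>. \<sigma> permutes {1..k} \<longrightarrow> Vector_Spaces.linear (*s) (*s) (\<rho> \<sigma>) \<and> bij (\<rho> \<sigma>) \<and>
      (\<forall>i\<in>{1..k}. \<forall>x. \<rho> \<sigma> (A i x) = A (\<sigma> i) (\<rho> \<sigma> x)))"
proof -
  have "(\<forall>i\<in>{1..k}. \<forall>x. f (A i (inv f x)) = A (\<sigma> i) x) \<longleftrightarrow>
      (\<forall>i\<in>{1..k}. \<forall>x. f (A i x) = A (\<sigma> i) (f x))" if "bij f" for f \<sigma>
    using that by (metis bij_inv_eq_iff)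
  then show ?thesis
    unfolding realization_map_def GL_on_def mem_Collect_eq End_on_UNIV_iff by blast
qed

lemma joint_eigenspace_realization:
  assumes \<rho>: "realization_map (*s) UNIV k A \<rho>" and \<sigma>: "\<sigma> permutes {1..k}"
  shows "\<rho> \<sigma> x \<in> joint_eigenspace k A (w \<circ> inv \<sigma>) \<longleftrightarrow> x \<in> joint_eigenspace k A w"
proof -
  have lin: "Vector_Spaces.linear (*s) (*s) (\<rho> \<sigma>)" and bij: "bij (\<rho> \<sigma>)"
    and comm: "\<And>i. i \<in> {1..k} \<Longrightarrow> \<rho> \<sigma> (A i x) = A (\<sigma> i) (\<rho> \<sigma> x)"
    using \<rho> \<sigma> by (auto simp: realization_map_UNIV_iff)
  have "\<rho> \<sigma> x \<in> joint_eigenspace k A (w \<circ> inv \<sigma>) \<longleftrightarrow>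
      (\<forall>i\<in>\<sigma> ` {1..k}. A i (\<rho> \<sigma> x) = w (inv \<sigma> i) *s \<rho> \<sigma> x)"
    unfolding joint_eigenspace_def permutes_image[OF \<sigma>] by simp
  also have "\<dots> \<longleftrightarrow> (\<forall>i\<in>{1..k}. \<rho> \<sigma> (A i x) = \<rho> \<sigma> (w i *s x))"
    by (simp add: comm permutes_inverses[OF \<sigma>] vec.linear_scale[OF lin] del: image_Suc_atLeastAtMost)
  also have "\<dots> \<longleftrightarrow> x \<in> joint_eigenspace k A w"
    using bij_is_inj[OF bij] by (simp add: joint_eigenspace_def inj_eq)
  finally show ?thesis .
qed

text \<open>
  Irreducibility quantifies over all realization maps, so \<open>\<rho>\<close> may be chosen to suit the subspace.
\<close>

lemma irreducible_invariant_subspace: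
  fixes A :: "nat \<Rightarrow> complex ^ 'n \<Rightarrow> complex ^ 'n"
  assumes "\<not> reducible (*s) UNIV k A" and "realization_map (*s) UNIV k A \<rho>"
    and W: "vec.subspace W" and x: "x \<in> W" "x \<noteq> 0"
    and "\<And>i. i \<in> {1..k} \<Longrightarrow> A i ` W \<subseteq> W"
    and "\<And>\<sigma>. \<sigma> permutes {1..k} \<Longrightarrow> \<rho> \<sigma> ` W \<subseteq> W"
  shows "W = UNIV"
proof (rule ccontr)
  assume "W \<noteq> UNIV"
  moreover have "vec.span W = W" "vec.span (UNIV :: (complex ^ 'n) set) = UNIV"
    using W by (simp_all only: vec.span_eq_iff vec.subspace_UNIV)
  ultimately have "vec.span W \<subset> vec.span (UNIV :: (complex ^ 'n) set)"
    by (simp only: psubset_eq subset_UNIV simp_thms)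
  then have "vec.dim W < vec.dim (UNIV :: (complex ^ 'n) set)"
    by (rule vec.dim_psubset)
  moreover have "vec.dim W \<noteq> 0" using x by auto
  ultimately show False
    using assms unfolding reducible_def by blast
qed


section \<open>Orbits of weights\<close>

lemma finite_weight_orbit: "finite (weight_orbit k lam)"
proof -
  have "weight_orbit k lam = (\<lambda>\<sigma>. lam \<circ> \<sigma>) ` {\<sigma>. \<sigma> permutes {1..k}}"
    by (auto simp: weight_orbit_def)
  then show ?thesis by (simp add: finite_permutations)
qed

lemma self_in_weight_orbit: "lam \<in> weight_orbit k lam"
  unfolding weight_orbit_def using permutes_id[of "{1..k}"] by (metis (mono_tags) CollectI comp_id)

lemma weight_orbit_comp_iff:
  assumes \<sigma>: "\<sigma> permutes {1..k}"
  shows "w \<circ> \<sigma> \<in> weight_orbit k lam \<longleftrightarrow> w \<in> weight_orbit k lam"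
proof -
  have closed: "v \<circ> \<tau> \<in> weight_orbit k lam"
    if "v \<in> weight_orbit k lam" "\<tau> permutes {1..k}" for v \<tau>
    using that by (auto simp: weight_orbit_def comp_assoc intro: permutes_compose)
  have "w \<circ> \<sigma> \<circ> inv \<sigma> = w"
    by (simp add: comp_assoc permutes_inv_o[OF \<sigma>])
  then show ?thesis
    using closed[OF _ \<sigma>, of w] closed[OF _ permutes_inv[OF \<sigma>], of "w \<circ> \<sigma>"] by auto
qed

lemma weight_orbit_subset_weights:
  assumes "lam \<in> weights k"
  shows "weight_orbit k lam \<subseteq> weights k"
proof
  fix w assume "w \<in> weight_orbit k lam"
  then obtain \<sigma> where "\<sigma> permutes {1..k}" "w = lam \<circ> \<sigma>" by (auto simp: weight_orbit_def)
  then show "w \<in> weights k"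
    using assms by (auto simp: weights_def PiE_def extensional_def permutes_not_in)
qed


section \<open>One-dimensional eigenspaces\<close>

text \<open>
  The span of the joint eigenspaces over an orbit of weights is invariant: each \<open>A i\<close> preserves every
  one of them, and a realization map permutes them.
\<close>

lemma irreducible_sum_of_eigenspaces:
  fixes A :: "nat \<Rightarrow> complex ^ 'n \<Rightarrow> complex ^ 'n"
  assumes lin: "\<And>i. i \<in> {1..k} \<Longrightarrow> Vector_Spaces.linear (*s) (*s) (A i)"
    and \<rho>: "realization_map (*s) UNIV k A \<rho>" and irred: "\<not> reducible (*s) UNIV k A"
    and e: "e \<in> joint_eigenspace k A lam" "e \<noteq> 0"
  shows "\<exists>y. (\<forall>w\<in>weight_orbit k lam. y w \<in> joint_eigenspace k A w) \<and>
    v = (\<Sum>w\<in>weight_orbit k lam. y w)"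
proof -
  define Orb where "Orb = weight_orbit k lam"
  define S where "S = (\<Union>w\<in>Orb. joint_eigenspace k A w)"
  have sub: "vec.subspace (joint_eigenspace k A w)" for w
    using lin by (rule subspace_joint_eigenspace)
  have "vec.span S = UNIV"
  proof (rule irreducible_invariant_subspace[OF irred \<rho>])
    show "vec.subspace (vec.span S)" by (rule vec.subspace_span)
    have "e \<in> S" using e self_in_weight_orbit by (auto simp: S_def Orb_def)
    then show "e \<in> vec.span S" by (rule vec.span_base)
    show "e \<noteq> 0" by fact
    show "A i ` vec.span S \<subseteq> vec.span S" if i: "i \<in> {1..k}" for i
    proof -
      have "A i x \<in> S" if x: "x \<in> S" for x
      proof -
        obtain w where w: "w \<in> Orb" "x \<in> joint_eigenspace k A w" using x by (auto simp: S_def)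
        then have "A i x = w i *s x" using i by (simp add: joint_eigenspace_def)
        then show ?thesis using w vec.subspace_scale[OF sub] by (auto simp: S_def)
      qed
      then have "A i ` S \<subseteq> S" by blast
      then show ?thesis
        using vec.linear_span_image[OF lin[OF i], of S] vec.span_mono[of "A i ` S" S] by simp
    qed
    show "\<rho> \<sigma> ` vec.span S \<subseteq> vec.span S" if \<sigma>: "\<sigma> permutes {1..k}" for \<sigma>
    proof -
      have "\<rho> \<sigma> x \<in> S" if x: "x \<in> S" for x
      proof -
        obtain w where w: "w \<in> Orb" "x \<in> joint_eigenspace k A w" using x by (auto simp: S_def)
        then have "\<rho> \<sigma> x \<in> joint_eigenspace k A (w \<circ> inv \<sigma>)"
          using joint_eigenspace_realization[OF \<rho> \<sigma>] by blast
        moreover have "w \<circ> inv \<sigma> \<in> Orb"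
          using w weight_orbit_comp_iff[OF permutes_inv[OF \<sigma>]] by (simp add: Orb_def)
        ultimately show ?thesis by (auto simp: S_def)
      qed
      then have "\<rho> \<sigma> ` S \<subseteq> S" by blast
      moreover have "Vector_Spaces.linear (*s) (*s) (\<rho> \<sigma>)"
        using \<rho> \<sigma> by (auto simp: realization_map_UNIV_iff)
      ultimately show ?thesis
        using vec.linear_span_image[of "\<rho> \<sigma>" S] vec.span_mono[of "\<rho> \<sigma> ` S" S] by simp
    qed
  qed
  then have "v \<in> vec.span S" by simp
  then have "\<exists>y. (\<forall>w\<in>Orb. y w \<in> joint_eigenspace k A w) \<and> v = (\<Sum>w\<in>Orb. y w)"
  proof (induction rule: vec.span_induct_alt)
    case base
    show ?case
      by (intro exI[of _ "\<lambda>_. 0"]) (auto intro: vec.subspace_0[OF sub])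
  next
    case (step c x z)
    obtain u where u: "u \<in> Orb" "x \<in> joint_eigenspace k A u" using step(1) by (auto simp: S_def)
    obtain y where y: "\<forall>w\<in>Orb. y w \<in> joint_eigenspace k A w" "z = (\<Sum>w\<in>Orb. y w)"
      using step(2) by blast
    have "c *s x + z = (\<Sum>w\<in>Orb. (if w = u then c *s x else 0) + y w)"
      using u finite_weight_orbit by (simp add: sum.distrib y Orb_def)
    moreover have "(if w = u then c *s x else 0) + y w \<in> joint_eigenspace k A w" if "w \<in> Orb" for w
      using y(1) u(2) that
      by (intro vec.subspace_add[OF sub]) (simp_all add: vec.subspace_scale[OF sub] vec.subspace_0[OF sub])
    ultimately show ?case
      by (intro exI[of _ "\<lambda>w. (if w = u then c *s x else 0) + y w"] conjI ballI)
  qed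
  then show ?thesis by (simp add: Orb_def)
qed

text \<open>
  In coordinates with respect to chosen isomorphisms \<open>\<phi> w\<close> from the eigenspace of \<open>lam\<close> to that of
  \<open>w\<close>, a vector is a function \<open>p v\<close> from the orbit to the eigenspace of \<open>lam\<close>. Then \<open>A i\<close> multiplies
  the value at \<open>w\<close> by \<open>w i\<close>, while composition with \<open>\<sigma>\<close> on the orbit gives a realization map. Both
  respect the condition that all values lie in the line of \<open>e\<close>.
\<close>

lemma irreducible_eigenbasis:
  fixes A :: "nat \<Rightarrow> complex ^ 'n \<Rightarrow> complex ^ 'n"
  assumes lin: "\<And>i. i \<in> {1..k} \<Longrightarrow> Vector_Spaces.linear (*s) (*s) (A i)"
    and \<rho>: "realization_map (*s) UNIV k A \<rho>" and irred: "\<not> reducible (*s) UNIV k A"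
    and lam: "lam \<in> weights k"
    and e: "e \<in> joint_eigenspace k A lam" "e \<noteq> 0"
  obtains E where "\<And>w. w \<in> weight_orbit k lam \<Longrightarrow> E w \<in> joint_eigenspace k A w"
    and "\<And>w. w \<in> weight_orbit k lam \<Longrightarrow> E w \<noteq> 0"
    and "\<And>v. \<exists>c. v = (\<Sum>w\<in>weight_orbit k lam. c w *s E w)"
proof -
  define Orb where "Orb = weight_orbit k lam"
  have Orb: "finite Orb" "Orb \<subseteq> weights k"
    using finite_weight_orbit weight_orbit_subset_weights[OF lam] by (simp_all add: Orb_def)
  have Orb_comp: "w \<circ> \<sigma> \<in> Orb \<longleftrightarrow> w \<in> Orb" if "\<sigma> permutes {1..k}" for w \<sigma>
    unfolding Orb_def using that by (rule weight_orbit_comp_iff)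
  have sub: "vec.subspace (joint_eigenspace k A w)" for w
    using lin by (rule subspace_joint_eigenspace)
  have "\<exists>\<tau>. \<tau> permutes {1..k} \<and> w = lam \<circ> inv \<tau>" if "w \<in> Orb" for w
  proof -
    obtain \<sigma> where "\<sigma> permutes {1..k}" "w = lam \<circ> \<sigma>"
      using \<open>w \<in> Orb\<close> by (auto simp: Orb_def weight_orbit_def)
    then show ?thesis
      by (intro exI[of _ "inv \<sigma>"] conjI permutes_inv) (simp_all add: permutes_inv_inv)
  qed
  then obtain \<tau> where \<tau>: "\<And>w. w \<in> Orb \<Longrightarrow> \<tau> w permutes {1..k}"
      "\<And>w. w \<in> Orb \<Longrightarrow> lam \<circ> inv (\<tau> w) = w"
    by metis
  define \<phi> where "\<phi> w = \<rho> (\<tau> w)" for w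
  have \<phi>_lin: "Vector_Spaces.linear (*s) (*s) (\<phi> w)" and \<phi>_bij: "bij (\<phi> w)" if "w \<in> Orb" for w
    using \<rho> \<tau>(1)[OF that] by (auto simp: \<phi>_def realization_map_UNIV_iff)
  have \<phi>_eig: "\<phi> w x \<in> joint_eigenspace k A w \<longleftrightarrow> x \<in> joint_eigenspace k A lam" if "w \<in> Orb" for w x
    using joint_eigenspace_realization[OF \<rho> \<tau>(1)[OF that], of x lam] \<tau>(2)[OF that]
    by (simp add: \<phi>_def)
  have \<phi>_0: "\<phi> w x = 0 \<longleftrightarrow> x = 0" if "w \<in> Orb" for w x
    using vec.linear_0[OF \<phi>_lin[OF that]] bij_is_inj[OF \<phi>_bij[OF that]] by (metis injD)

  \<comment> \<open>The value 0 off the orbit makes the coordinate function of a vector unique as a total function.\<close>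
  define coords where "coords z v \<longleftrightarrow> (\<forall>w\<in>Orb. z w \<in> joint_eigenspace k A lam) \<and>
    (\<forall>w. w \<notin> Orb \<longrightarrow> z w = 0) \<and> v = (\<Sum>w\<in>Orb. \<phi> w (z w))" for z v
  have coords_ex: "\<exists>z. coords z v" for v
  proof -
    obtain y where y: "\<And>w. w \<in> Orb \<Longrightarrow> y w \<in> joint_eigenspace k A w" "v = (\<Sum>w\<in>Orb. y w)"
      using irreducible_sum_of_eigenspaces[OF lin \<rho> irred e, of v] by (auto simp: Orb_def)
    define z where "z w = (if w \<in> Orb then inv (\<phi> w) (y w) else 0)" for w
    have \<phi>z: "\<phi> w (z w) = y w" if "w \<in> Orb" for w
      using that bij_is_surj[OF \<phi>_bij[OF that]] by (simp add: z_def surj_f_inv_f)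
    have "coords z v"
      unfolding coords_def
    proof (intro conjI ballI allI impI)
      show "z w \<in> joint_eigenspace k A lam" if "w \<in> Orb" for w
        using y(1)[OF that] \<phi>z[OF that] \<phi>_eig[OF that, of "z w"] by simp
      show "z w = 0" if "w \<notin> Orb" for w using that by (simp add: z_def)
      show "v = (\<Sum>w\<in>Orb. \<phi> w (z w))" by (simp add: \<phi>z y(2))
    qed
    then show ?thesis by blast
  qed
  have coords_diff: "coords (\<lambda>w. z w - z' w) (v - v')" if "coords z v" "coords z' v'" for z z' v v'
    using that unfolding coords_def
    by (auto simp: vec.linear_diff[OF \<phi>_lin] sum_subtractf intro: vec.subspace_diff[OF sub])
  have coords_0: "z w = 0" if z: "coords z 0" for z w
  proof (cases "w \<in> Orb")
    case True
    have "\<phi> w (z w) = 0"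
      using z \<phi>_eig True Orb
      by (intro joint_eigenspaces_independent[OF lin, where F = Orb and y = "\<lambda>w. \<phi> w (z w)"])
        (auto simp: coords_def)
    then show ?thesis using \<phi>_0[OF True] by simp
  qed (use z in \<open>simp add: coords_def\<close>)
  define p where "p v = (SOME z. coords z v)" for v
  have coords_p: "coords (p v) v" for v
    unfolding p_def by (rule someI_ex[OF coords_ex])
  have p_eqI: "p v = z" if "coords z v" for z v
  proof
    fix w show "p v w = z w"
      using coords_0[of "\<lambda>w. p v w - z w" w] coords_diff[OF coords_p that, of v] by simp
  qed
  have p_eig: "p v w \<in> joint_eigenspace k A lam" if "w \<in> Orb" for v w
    using coords_p[of v] that by (simp add: coords_def)
  have p_outside: "p v w = 0" if "w \<notin> Orb" for v w
    using coords_p[of v] that by (simp add: coords_def)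
  have p_sum: "v = (\<Sum>w\<in>Orb. \<phi> w (p v w))" for v
    using coords_p[of v] by (simp add: coords_def)
  have p_add: "p (u + v) = (\<lambda>w. p u w + p v w)" for u v
  proof (rule p_eqI)
    show "coords (\<lambda>w. p u w + p v w) (u + v)"
      using coords_p[of u] coords_p[of v] unfolding coords_def
      by (auto simp: vec.linear_add[OF \<phi>_lin] sum.distrib intro: vec.subspace_add[OF sub])
  qed
  have p_scale: "p (c *s v) = (\<lambda>w. c *s p v w)" for c v
  proof (rule p_eqI)
    show "coords (\<lambda>w. c *s p v w) (c *s v)"
      unfolding coords_def
      by (auto simp: vec.linear_scale[OF \<phi>_lin] p_outside
          simp flip: vec.scale_sum_right p_sum intro: vec.subspace_scale[OF sub p_eig])
  qed
  have A_sum: "A i v = (\<Sum>w\<in>Orb. w i *s \<phi> w (p v w))" if i: "i \<in> {1..k}" for i v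
  proof -
    have "A i v = (\<Sum>w\<in>Orb. A i (\<phi> w (p v w)))"
      using arg_cong[OF p_sum[of v], of "A i"] by (simp only: vec.linear_sum[OF lin[OF i]])
    also have "\<dots> = (\<Sum>w\<in>Orb. w i *s \<phi> w (p v w))"
    proof (rule sum.cong)
      fix w assume "w \<in> Orb"
      then have "\<phi> w (p v w) \<in> joint_eigenspace k A w" using \<phi>_eig p_eig by blast
      then show "A i (\<phi> w (p v w)) = w i *s \<phi> w (p v w)"
        using i by (simp add: joint_eigenspace_def)
    qed simp
    finally show ?thesis .
  qed
  have p_A: "p (A i v) = (\<lambda>w. w i *s p v w)" if i: "i \<in> {1..k}" for i v
  proof (rule p_eqI)
    show "coords (\<lambda>w. w i *s p v w) (A i v)"
      unfolding coords_def
      by (auto simp: A_sum[OF i] vec.linear_scale[OF \<phi>_lin] p_outside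
          intro: vec.subspace_scale[OF sub p_eig])
  qed

  \<comment> \<open>The value of \<open>\<rho>' \<sigma> v\<close> at \<open>w \<circ> inv \<sigma>\<close> is that of \<open>v\<close> at \<open>w\<close>, whence the argument \<open>w \<circ> \<sigma>\<close> here.\<close>
  define \<rho>' where "\<rho>' \<sigma> v = (\<Sum>w\<in>Orb. \<phi> w (p v (w \<circ> \<sigma>)))" for \<sigma> v
  have p_\<rho>': "p (\<rho>' \<sigma> v) = (\<lambda>w. p v (w \<circ> \<sigma>))" if \<sigma>: "\<sigma> permutes {1..k}" for \<sigma> v
  proof (rule p_eqI)
    show "coords (\<lambda>w. p v (w \<circ> \<sigma>)) (\<rho>' \<sigma> v)"
      using Orb_comp[OF \<sigma>] by (auto simp: coords_def \<rho>'_def intro: p_eig p_outside)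
  qed
  have \<rho>'_comp: "\<rho>' \<sigma> (\<rho>' \<tau> v) = \<rho>' (\<sigma> \<circ> \<tau>) v"
    if "\<sigma> permutes {1..k}" "\<tau> permutes {1..k}" for \<sigma> \<tau> v
    by (simp add: \<rho>'_def[of \<sigma>] \<rho>'_def[of "\<sigma> \<circ> \<tau>"] p_\<rho>'[OF that(2)] comp_assoc)
  have \<rho>'_id: "\<rho>' id v = v" for v
    by (simp add: \<rho>'_def flip: p_sum)
  have \<rho>': "realization_map (*s) UNIV k A \<rho>'"
    unfolding realization_map_UNIV_iff
  proof (intro allI impI conjI ballI)
    fix \<sigma> assume \<sigma>: "\<sigma> permutes {1..k}"
    show "Vector_Spaces.linear (*s) (*s) (\<rho>' \<sigma>)"
      unfolding Vector_Spaces.linear_iff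
      by (auto simp: vec.vector_space_axioms \<rho>'_def p_add p_scale vec.linear_add[OF \<phi>_lin]
          vec.linear_scale[OF \<phi>_lin] sum.distrib vec.scale_sum_right)
    have "\<rho>' \<sigma> \<circ> \<rho>' (inv \<sigma>) = id" "\<rho>' (inv \<sigma>) \<circ> \<rho>' \<sigma> = id"
      by (simp_all add: fun_eq_iff \<rho>'_comp[OF \<sigma> permutes_inv[OF \<sigma>]]
          \<rho>'_comp[OF permutes_inv[OF \<sigma>] \<sigma>] permutes_inv_o[OF \<sigma>] \<rho>'_id[unfolded id_def] id_def)
    then show "bij (\<rho>' \<sigma>)" by (rule o_bij[rotated])
    fix i v assume i: "i \<in> {1..k}"
    then have "\<sigma> i \<in> {1..k}" using permutes_in_image[OF \<sigma>] by blast
    then show "\<rho>' \<sigma> (A i v) = A (\<sigma> i) (\<rho>' \<sigma> v)"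
      by (simp only: A_sum p_\<rho>'[OF \<sigma>] \<rho>'_def[of \<sigma> "A i v"] p_A[OF i])
        (simp add: vec.linear_scale[OF \<phi>_lin])
  qed

  define W where "W = {v. \<forall>w\<in>Orb. p v w \<in> vec.span {e}}"
  have "W = UNIV"
  proof (rule irreducible_invariant_subspace[OF irred \<rho>'])
    have "p 0 w = 0" for w
      using p_scale[of 0 0] by simp
    then show "vec.subspace W"
      unfolding W_def vec.subspace_def
      by (auto simp: p_add p_scale intro: vec.span_add vec.span_scale vec.span_zero)
    define v where "v = (\<Sum>w\<in>Orb. \<phi> w e)"
    have "p v = (\<lambda>w. if w \<in> Orb then e else 0)"
      using e by (intro p_eqI) (auto simp: coords_def v_def)
    then have p_v: "p v w = e" if "w \<in> Orb" for w using that by simp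
    then show "v \<in> W" by (simp add: W_def vec.span_base)
    have "p v lam = e" by (rule p_v) (simp add: Orb_def self_in_weight_orbit)
    then show "v \<noteq> 0" using e(2) \<open>\<And>w. p 0 w = 0\<close> by metis
    show "A i ` W \<subseteq> W" if "i \<in> {1..k}" for i
      unfolding W_def by (intro image_subsetI CollectI) (simp add: p_A[OF that] vec.span_scale)
    show "\<rho>' \<sigma> ` W \<subseteq> W" if "\<sigma> permutes {1..k}" for \<sigma>
      unfolding W_def by (intro image_subsetI CollectI) (simp add: p_\<rho>'[OF that] Orb_comp[OF that])
  qed
  have "\<exists>c. v = (\<Sum>w\<in>Orb. c w *s \<phi> w e)" for v
  proof -
    have "\<forall>w\<in>Orb. \<exists>c. p v w = c *s e"
      using \<open>W = UNIV\<close> by (auto simp: W_def vec.span_singleton)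
    then obtain c where "\<And>w. w \<in> Orb \<Longrightarrow> p v w = c w *s e" by metis
    then have "v = (\<Sum>w\<in>Orb. c w *s \<phi> w e)"
      using p_sum[of v] by (simp add: vec.linear_scale[OF \<phi>_lin])
    then show ?thesis by blast
  qed
  then show thesis
    using \<phi>_eig \<phi>_0 e by (intro that[of "\<lambda>w. \<phi> w e"]) (simp_all add: Orb_def)
qed


section \<open>The isomorphism and the dimension\<close>

text \<open>
  The map \<open>S\<close> that sends the basis vector of \<open>w\<close> to \<open>E w\<close> is bijective: its image contains
  everything by the spanning hypothesis, and its kernel vanishes because the \<open>E w\<close> are nonzero vectors
  of independent eigenspaces. It goes from the model to \<open>\<complex>\<^sup>n\<close>; the isomorphism sought is its inverse.
\<close>

lemma isomorphic_weight_op_of_eigenbasis: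
  fixes A :: "nat \<Rightarrow> complex ^ 'n \<Rightarrow> complex ^ 'n"
  assumes lin: "\<And>i. i \<in> {1..k} \<Longrightarrow> Vector_Spaces.linear (*s) (*s) (A i)"
    and lam: "lam \<in> weights k"
    and eig: "\<And>w. w \<in> weight_orbit k lam \<Longrightarrow> E w \<in> joint_eigenspace k A w"
    and nz: "\<And>w. w \<in> weight_orbit k lam \<Longrightarrow> E w \<noteq> 0"
    and spans: "\<And>v. \<exists>c. v = (\<Sum>w\<in>weight_orbit k lam. c w *s E w)"
  shows "isomorphic_on (*s) UNIV free_scale (weight_space k lam) k A weight_op"
proof -
  define Orb where "Orb = weight_orbit k lam"
  have fin: "finite Orb" by (simp add: Orb_def finite_weight_orbit)
  define S :: "((nat \<Rightarrow> complex) \<Rightarrow>\<^sub>0 complex) \<Rightarrow> complex ^ 'n"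
    where "S y = (\<Sum>w\<in>Orb. Poly_Mapping.lookup y w *s E w)" for y
  have space: "weight_space k lam = {y. Poly_Mapping.keys y \<subseteq> Orb}"
    by (simp add: weight_space_eq Orb_def)
  have S_add: "S (x + y) = S x + S y" for x y
    by (simp add: S_def lookup_add vec.scale_left_distrib sum.distrib)
  have S_scale: "S (free_scale c y) = c *s S y" for c y
    by (simp add: S_def vec.scale_sum_right)
  have S_op: "S (weight_op i y) = A i (S y)" if i: "i \<in> {1..k}" for i y
  proof -
    have "A i (E w) = w i *s E w" if "w \<in> Orb" for w
      using eig[of w] that i by (simp add: joint_eigenspace_def Orb_def)
    then show ?thesis
      by (simp add: S_def lookup_weight_op vec.linear_sum[OF lin[OF i]]
          vec.linear_scale[OF lin[OF i]] mult.commute)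
  qed
  have S_inj: "y = 0" if y: "S y = 0" "y \<in> weight_space k lam" for y
  proof (rule poly_mapping_eqI)
    fix w show "Poly_Mapping.lookup y w = Poly_Mapping.lookup 0 w"
    proof (cases "w \<in> Orb")
      case True
      have "Poly_Mapping.lookup y w *s E w = 0"
        using fin weight_orbit_subset_weights[OF lam] y(1) True
        by (intro joint_eigenspaces_independent[OF lin, where F = Orb and y = "\<lambda>w. Poly_Mapping.lookup y w *s E w"])
          (auto simp: S_def Orb_def
            intro: vec.subspace_scale[OF subspace_joint_eigenspace[OF lin] eig])
      then show ?thesis using nz[of w] True by (simp add: Orb_def)
    next
      case False
      then show ?thesis using y(2) by (auto simp: space in_keys_iff)
    qed
  qed
  have "bij_betw S (weight_space k lam) UNIV"
    unfolding bij_betw_def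
  proof
    show "inj_on S (weight_space k lam)"
    proof (rule inj_onI)
      fix x y assume xy: "x \<in> weight_space k lam" "y \<in> weight_space k lam" "S x = S y"
      have "S (x - y) = 0" using S_add[of "x - y" y] xy(3) by simp
      moreover have "x - y \<in> weight_space k lam"
        using xy(1,2) unfolding weight_space_def by (rule free.span_diff)
      ultimately show "x = y" using S_inj by fastforce
    qed
    show "S ` weight_space k lam = UNIV"
    proof (intro equalityI subset_UNIV subsetI)
      fix v :: "complex ^ 'n"
      obtain c where c: "v = (\<Sum>w\<in>Orb. c w *s E w)" using spans[of v] by (auto simp: Orb_def)
      define y where "y = (\<Sum>w\<in>Orb. Poly_Mapping.single w (c w))"
      have look: "Poly_Mapping.lookup y w = (if w \<in> Orb then c w else 0)" for w
        using fin by (simp add: y_def lookup_sum lookup_single when_def)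
      then have "y \<in> weight_space k lam" by (auto simp: space in_keys_iff split: if_splits)
      moreover have "S y = v" by (simp add: S_def look c)
      ultimately show "v \<in> S ` weight_space k lam" by blast
    qed
  qed
  define T where "T = inv_into (weight_space k lam) S"
  have T_bij: "bij_betw T UNIV (weight_space k lam)"
    unfolding T_def by (rule bij_betw_inv_into) fact
  have T_in: "T v \<in> weight_space k lam" for v
    using bij_betwE[OF T_bij] by blast
  have ST: "S (T v) = v" for v
    using \<open>bij_betw S _ _\<close> by (simp add: T_def bij_betw_inv_into_right)
  have TS: "T (S y) = y" if "y \<in> weight_space k lam" for y
    using \<open>bij_betw S _ _\<close> that by (simp add: T_def bij_betw_inv_into_left)
  have inv_T: "inv_into UNIV T y = S y" if "y \<in> weight_space k lam" for y
    using T_bij TS[OF that] by (intro inv_into_f_eq) (auto simp: bij_betw_def)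
  have "T \<in> linear_between (*s) UNIV free_scale (weight_space k lam)"
    unfolding linear_between_def
  proof (intro CollectI conjI ballI allI)
    show "T x \<in> weight_space k lam" for x by (rule T_in)
    show "T (x + y) = T x + T y" for x y
    proof -
      have "T x + T y \<in> weight_space k lam"
        using T_in[of x] T_in[of y] unfolding weight_space_def by (rule free.span_add)
      then show ?thesis using TS[of "T x + T y"] by (simp add: S_add ST)
    qed
    show "T (c *s x) = free_scale c (T x)" for c x
    proof -
      have "free_scale c (T x) \<in> weight_space k lam"
        using T_in[of x] unfolding weight_space_def by (rule free.span_scale)
      then show ?thesis using TS[of "free_scale c (T x)"] by (simp add: S_scale ST)
    qed
  qed
  moreover have "weight_op i y = T (A i (inv_into UNIV T y))"
    if "i \<in> {1..k}" "y \<in> weight_space k lam" for i y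
  proof -
    have "weight_op i y \<in> weight_space k lam"
      using that(2) by (auto simp: space in_keys_iff lookup_weight_op)
    then show ?thesis
      using TS S_op[OF that(1), of y] inv_T[OF that(2)] by metis
  qed
  ultimately show ?thesis
    unfolding isomorphic_on_def using T_bij by blast
qed

lemma dim_weight_space: "free.dim (weight_space k lam) = card (weight_orbit k lam)"
proof -
  have "inj (\<lambda>w :: nat \<Rightarrow> complex. Poly_Mapping.single w (1 :: complex))"
    by (rule injI) (metis lookup_single_eq lookup_single_not_eq zero_neq_one)
  then show ?thesis
    unfolding weight_space_def free.dim_span
    by (simp add: free.dim_eq_card_independent[OF free_independent_basis] card_image inj_on_subset)
qed

text \<open>
  A weight in the orbit is determined by its list of values on \<open>{1..k}\<close>, since outside it agrees
  with \<open>lam\<close>. Two lists with the same multiset of entries differ by a permutation of positions;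
  positions start at 0 and indices at 1, hence the shift by one in the last part.
\<close>

lemma bij_betw_weight_orbit_permutations_of_multiset:
  "bij_betw (\<lambda>w. map w [1..<Suc k]) (weight_orbit k lam)
     (permutations_of_multiset (mset (map lam [1..<Suc k])))"
proof -
  have set: "set [1..<Suc k] = {1..k}" by auto
  show ?thesis
    unfolding bij_betw_def
  proof (intro conjI equalityI)
    show "inj_on (\<lambda>w. map w [1..<Suc k]) (weight_orbit k lam)"
    proof (rule inj_onI, rule ext)
      fix v w i
      assume vw: "v \<in> weight_orbit k lam" "w \<in> weight_orbit k lam"
        and eq: "map v [1..<Suc k] = map w [1..<Suc k]"
      show "v i = w i"
      proof (cases "i \<in> {1..k}")
        case True
        then show ?thesis using eq unfolding map_eq_conv set by blast
      next
        case False
        then show ?thesis using vw by (auto simp: weight_orbit_def permutes_not_in)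
      qed
    qed
  next
    show "(\<lambda>w. map w [1..<Suc k]) ` weight_orbit k lam \<subseteq>
        permutations_of_multiset (mset (map lam [1..<Suc k]))"
    proof clarify
      fix w assume "w \<in> weight_orbit k lam"
      then obtain \<sigma> where \<sigma>: "\<sigma> permutes {1..k}" "w = lam \<circ> \<sigma>" by (auto simp: weight_orbit_def)
      have "image_mset \<sigma> (mset_set {1..k}) = mset_set {1..k}"
        using \<sigma>(1) by (simp add: image_mset_mset_set permutes_inj_on permutes_image)
      moreover have "mset [1..<Suc k] = mset_set {1..k}"
        by (simp add: atLeastLessThanSuc_atLeastAtMost del: upt_Suc)
      ultimately have "mset (map w [1..<Suc k]) = mset (map lam [1..<Suc k])"
        by (simp only: \<sigma>(2) mset_map multiset.map_comp[symmetric])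
      then show "map w [1..<Suc k] \<in> permutations_of_multiset (mset (map lam [1..<Suc k]))"
        by (rule permutations_of_multisetI)
    qed
  next
    show "permutations_of_multiset (mset (map lam [1..<Suc k])) \<subseteq>
        (\<lambda>w. map w [1..<Suc k]) ` weight_orbit k lam"
    proof
      fix xs assume "xs \<in> permutations_of_multiset (mset (map lam [1..<Suc k]))"
      then have xs: "mset xs = mset (map lam [1..<Suc k])"
        by (rule permutations_of_multisetD)
      then have len: "length xs = k" using mset_eq_length[OF xs] by (simp del: upt_Suc)
      obtain \<pi> where "\<pi> permutes {..<length (map lam [1..<Suc k])}"
        and perm: "permute_list \<pi> (map lam [1..<Suc k]) = xs"
        using mset_eq_permutation[OF xs] .
      then have \<pi>: "\<pi> permutes {..<k}" by (simp del: upt_Suc)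
      define \<sigma> where "\<sigma> i = (if i \<in> {1..k} then Suc (\<pi> (i - 1)) else i)" for i
      have down: "bij_betw (\<lambda>i. i - 1) {1..k} {..<k}"
        by (rule bij_betwI[where g = Suc]) auto
      have mid: "bij_betw \<pi> {..<k} {..<k}" by (rule permutes_imp_bij[OF \<pi>])
      have up: "bij_betw Suc {..<k} {1..k}"
        by (rule bij_betwI[where g = "\<lambda>i. i - 1"]) auto
      have "bij_betw (Suc \<circ> (\<pi> \<circ> (\<lambda>i. i - 1))) {1..k} {1..k}"
        by (rule bij_betw_trans[OF bij_betw_trans[OF down mid] up])
      then have "bij_betw \<sigma> {1..k} {1..k}"
        by (subst bij_betw_cong[of _ \<sigma> "Suc \<circ> (\<pi> \<circ> (\<lambda>i. i - 1))"]) (auto simp: \<sigma>_def)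
      then have "\<sigma> permutes {1..k}"
        by (rule bij_imp_permutes) (auto simp: \<sigma>_def)
      moreover have "map (lam \<circ> \<sigma>) [1..<Suc k] = xs"
      proof (rule nth_equalityI)
        fix j assume "j < length (map (lam \<circ> \<sigma>) [1..<Suc k])"
        then have j: "j < k" by (simp del: upt_Suc)
        have "\<pi> j < k" using permutes_in_image[OF \<pi>] j by auto
        then have "xs ! j = lam (Suc (\<pi> j))"
          using j by (simp add: permute_list_nth \<pi> del: upt_Suc flip: perm)
        then show "map (lam \<circ> \<sigma>) [1..<Suc k] ! j = xs ! j"
          using j by (simp add: \<sigma>_def del: upt_Suc)
      qed (simp add: len del: upt_Suc)
      ultimately show "xs \<in> (\<lambda>w. map w [1..<Suc k]) ` weight_orbit k lam"
        unfolding weight_orbit_def by blast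
    qed
  qed
qed

text \<open>
  The multiplicity of a value \<open>c\<close> in the list of values of \<open>lam\<close> is the size of the level set of \<open>c\<close>.
\<close>

lemma card_weight_orbit:
  "card (weight_orbit k lam) * (\<Prod>L\<in>level_sets k lam. fact (card L)) = fact k"
proof -
  define M where "M = mset (map lam [1..<Suc k])"
  have set_M: "set_mset M = lam ` {1..k}"
    unfolding M_def set_mset_mset set_map by auto
  have count_M: "count M c = card {i \<in> {1..k}. lam i = c}" for c
  proof -
    have "count M c = length (filter (\<lambda>i. lam i = c) [1..<Suc k])"
      unfolding M_def count_mset count_list_eq_length_filter
      by (simp add: filter_map o_def eq_commute[of c] del: upt_Suc)
    also have "\<dots> = card {i \<in> {1..k}. lam i = c}"
      by (subst distinct_card[symmetric]) (auto intro: arg_cong[where f = card] simp del: upt_Suc)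
    finally show ?thesis .
  qed
  have "inj_on (\<lambda>c. {i \<in> {1..k}. lam i = c}) (lam ` {1..k})"
    by (rule inj_onI) blast
  then have "(\<Prod>L\<in>level_sets k lam. fact (card L)) = (\<Prod>c\<in>set_mset M. fact (count M c) :: nat)"
    unfolding level_sets_def set_M count_M by (simp only: prod.reindex o_def)
  moreover have "card (weight_orbit k lam) = card (permutations_of_multiset M)"
    unfolding M_def by (rule bij_betw_same_card) (rule bij_betw_weight_orbit_permutations_of_multiset)
  moreover have "size M = k" by (simp add: M_def del: upt_Suc)
  ultimately show ?thesis using card_permutations_of_multiset_aux[of M] by (simp only:)
qed

theorem theorem3:
  fixes A :: "nat \<Rightarrow> complex ^ 'n \<Rightarrow> complex ^ 'n" and k :: nat
  assumes "totally_symmetric (*s) UNIV k A"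
    and "commutative_on UNIV k A"
    and "\<not> reducible (*s) UNIV k A"
  shows "\<exists>lam \<in> weights k.
    isomorphic_on (*s) UNIV free_scale (weight_space k lam) k A weight_op \<and>
    real (free.dim (weight_space k lam)) = fact k / (\<Prod>L \<in> level_sets k lam. fact (card L))"
proof -
  have lin: "Vector_Spaces.linear (*s) (*s) (A i)" if "i \<in> {1..k}" for i
    using assms(1) that by (auto simp: totally_symmetric_def End_on_UNIV_iff)
  obtain \<rho> where \<rho>: "realization_map (*s) UNIV k A \<rho>"
    using assms(1) by (auto simp: totally_symmetric_def)
  obtain w e where e: "e \<noteq> 0" "e \<in> joint_eigenspace k A w"
    using common_eigenvector[OF lin assms(2)] by blast
  \<comment> \<open>Being a weight requires the default value outside \<open>{1..k}\<close>, where the eigenvector fixes nothing.\<close>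
  define lam where "lam = restrict w {1..k}"
  have lam: "lam \<in> weights k" by (simp add: lam_def weights_def)
  have "e \<in> joint_eigenspace k A lam"
    using e(2) by (simp add: joint_eigenspace_def lam_def)
  then obtain E where E: "\<And>w. w \<in> weight_orbit k lam \<Longrightarrow> E w \<in> joint_eigenspace k A w"
      "\<And>w. w \<in> weight_orbit k lam \<Longrightarrow> E w \<noteq> 0"
      "\<And>v. \<exists>c. v = (\<Sum>w\<in>weight_orbit k lam. c w *s E w)"
    using irreducible_eigenbasis[OF lin \<rho> assms(3) lam _ e(1)] by blast
  have "isomorphic_on (*s) UNIV free_scale (weight_space k lam) k A weight_op"
    by (rule isomorphic_weight_op_of_eigenbasis[OF lin lam E])
  moreover have "real (card (weight_orbit k lam)) * (\<Prod>L \<in> level_sets k lam. fact (card L)) = fact k"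
    using arg_cong[OF card_weight_orbit[of k lam], of real] by (simp add: of_nat_prod)
  then have "real (free.dim (weight_space k lam)) = fact k / (\<Prod>L \<in> level_sets k lam. fact (card L))"
    unfolding dim_weight_space by (subst eq_divide_eq) (auto simp: level_sets_def)
  ultimately show ?thesis using lam by blast
qed

end
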